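(* The hypergeometric sequence $$A(n) = \frac{\left(\tfrac{1}{9}\right)_n \left(\tfrac{4}{9}\right)_n \left(\tfrac{5}{9}\right)_n}{n!^2 \left(\tfrac{1}{3}\right)_n}, \quad n \geq 0,$$ is not a constant term sequence.
   Context: $(x)_n = x(x+1)\cdots(x+n-1)$ denotes the rising factorial (with $(x)_0 = 1$). Constant term: for a Laurent polynomial $F \in \mathbb{Q}[\boldsymbol{x}^{\pm 1}] = \mathbb{Q}[x_1^{\pm 1}, \ldots, x_d^{\pm 1}]$, $\operatorname{ct}[F]$ denotes its constant coefficient. A sequence $(A(n))_{n \geq 0}$ is a constant term (sequence) if there exist $d$ and $P, Q \in \mathbb{Q}[x_1^{\pm 1}, \ldots, x_d^{\pm 1}]$ such that $A(n) = \operatorname{ct}[P(\boldsymbol{x})^n Q(\boldsymbol{x})]$ for all $n \geq 0$. *)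

theory Defs
  imports Complex_Main "HOL-Library.Poly_Mapping"
begin

text \<open>
  Laurent polynomials over the rationals are elements of the monoid algebra of finitely
  supported integer exponent vectors: \<open>Poly_Mapping.lookup P m\<close> is the coefficient of the
  monomial with exponent vector \<open>m\<close>, and multiplication is the convolution product of
  \<^theory>\<open>HOL-Library.Poly_Mapping\<close>. Variables are numbered from 0, and \<open>laurent_polys d\<close>
  consists of the Laurent polynomials in the first \<open>d\<close> variables.
\<close>

type_synonym laurent = "(nat \<Rightarrow>\<^sub>0 int) \<Rightarrow>\<^sub>0 rat"

definition laurent_polys :: "nat \<Rightarrow> laurent set" where
  "laurent_polys d = {P. \<forall>m \<in> Poly_Mapping.keys P. Poly_Mapping.keys m \<subseteq> {..<d}}"

definition ct :: "laurent \<Rightarrow> rat" where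
  "ct F = Poly_Mapping.lookup F 0"

definition constant_term_seq :: "(nat \<Rightarrow> rat) \<Rightarrow> bool" where
  "constant_term_seq A \<longleftrightarrow>
     (\<exists>d. \<exists>P \<in> laurent_polys d. \<exists>Q \<in> laurent_polys d. \<forall>n. A n = ct (P ^ n * Q))"

end

theory Submission
  imports Defs "HOL-Number_Theory.Number_Theory"
begin

text \<open>
  The obstruction is a congruence between the values of \<open>A\<close> at \<open>p\<close> and at \<open>p\<^sup>2\<close>, for a large
  prime \<open>p\<close>.

  On the side of constant terms, clear denominators, so that \<open>P\<close> and \<open>Q\<close> have integer
  coefficients. By the freshman's dream, \<open>P\<close> to the power \<open>q = p\<^sup>k\<close> is congruent modulo \<open>p\<close> to the
  polynomial obtained from \<open>P\<close> by replacing each variable by its \<open>q\<close>-th power. As soon as \<open>p\<close>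
  exceeds every exponent in \<open>Q\<close>, the only products of monomials contributing to the constant term
  of \<open>P\<^sup>q Q\<close> come from the two constant coefficients, so that
  \<open>A(p\<^sup>k) \<equiv> ct P \<cdot> ct Q\<close> modulo \<open>p\<close> for every \<open>k \<ge> 1\<close>
  (\<open>ct_power_prime_cong\<close>, \<open>constant_term_seq_cong\<close>). In particular \<open>A(p) \<equiv> A(p\<^sup>2)\<close>.

  On the hypergeometric side, put \<open>F\<^sub>c(n) = c (c + 9) \<cdots> (c + 9 (n - 1))\<close>. All powers of \<open>9\<close>
  cancel and \<open>A = F\<^sub>1 F\<^sub>4 F\<^sub>5 / (F\<^sub>9\<^sup>2 F\<^sub>3)\<close>. Among \<open>p\<close> consecutive factors exactly one is divisible
  by \<open>p\<close>, and the others represent all nonzero residues, with product \<open>-1\<close> by Wilson's theorem.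
  Taking one factor \<open>p\<close> out of each of the \<open>n\<close> blocks therefore turns \<open>F\<^sub>c(p n)\<close> into
  \<open>F\<^sub>c\<^sub>'(n)\<close>, times a cofactor congruent to \<open>(-1)\<^sup>n\<close> modulo \<open>p\<close>, where \<open>1 \<le> c' \<le> 9\<close> and
  \<open>p c' \<equiv> c\<close> modulo \<open>9\<close> (this is Dwork's prime operation on the parameter \<open>c/9\<close>;
  \<open>progression_prod_prime_mult\<close>). Hence modulo \<open>p\<close>, the value
  \<open>A(p)\<close> is \<open>1' 4' 5' / (81 \<cdot> 3')\<close>, and \<open>A(p\<^sup>2)\<close> is the same expression with the operation
  applied twice. For \<open>p\<close> congruent to \<open>2\<close>, \<open>5\<close>, \<open>8\<close> modulo \<open>9\<close>, the value of \<open>A(p)\<close> is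
  \<open>35/243\<close>, \<open>8/243\<close>, \<open>80/243\<close>, while that of \<open>A(p\<^sup>2)\<close> is \<open>56/243\<close>, \<open>56/243\<close>, \<open>20/243\<close>. These
  differ modulo large \<open>p\<close>, and there are infinitely many primes congruent to \<open>2\<close> modulo \<open>3\<close>.
\<close>

section \<open>The freshman's dream\<close>

lemma freshmans_dream_dvd:
  fixes x y :: "'a :: comm_ring_1"
  assumes "prime p"
  shows "of_nat p dvd (x + y) ^ p - (x ^ p + y ^ p)"
proof -
  have p: "p > 0" using assms by (simp add: prime_gt_0_nat)
  let ?t = "\<lambda>k. of_nat (p choose k) * x ^ k * y ^ (p - k)"
  have "(x + y) ^ p = (\<Sum>k\<le>p. ?t k)"
    by (rule binomial_ring)
  also have "{..p} = insert 0 (insert p {0<..<p})"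
    using p by auto
  also have "(\<Sum>k\<in>\<dots>. ?t k) = y ^ p + (x ^ p + (\<Sum>k\<in>{0<..<p}. ?t k))"
    using p by simp
  finally have "(x + y) ^ p - (x ^ p + y ^ p) = (\<Sum>k\<in>{0<..<p}. ?t k)"
    by simp
  moreover have "of_nat p dvd (\<Sum>k\<in>{0<..<p}. ?t k)"
  proof (rule dvd_sum)
    fix k assume k: "k \<in> {0<..<p}"
    then have "p dvd p choose k"
      using assms p by (intro dvd_choose_prime) auto
    then have "(of_nat p :: 'a) dvd of_nat (p choose k)"
      by (auto elim!: dvdE)
    then show "of_nat p dvd ?t k"
      by (simp add: mult.assoc)
  qed
  ultimately show ?thesis by simp
qed

lemma freshmans_dream_sum_dvd:
  fixes f :: "'b \<Rightarrow> 'a :: comm_ring_1"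
  assumes "prime p" "finite A"
  shows "of_nat p dvd (\<Sum>i\<in>A. f i) ^ p - (\<Sum>i\<in>A. f i ^ p)"
  using assms(2)
proof (induction A rule: finite_induct)
  case empty
  then show ?case using assms(1) by (simp add: prime_gt_0_nat power_0_left)
next
  case (insert a A)
  let ?S = "\<Sum>i\<in>A. f i"
  have "of_nat p dvd ((f a + ?S) ^ p - (f a ^ p + ?S ^ p)) + (?S ^ p - (\<Sum>i\<in>A. f i ^ p))"
    using freshmans_dream_dvd[OF assms(1)] insert.IH by (rule dvd_add)
  then show ?case using insert.hyps by (simp add: algebra_simps)
qed

lemma dvd_diff_power:
  fixes x y :: "'a :: comm_ring_1"
  assumes "d dvd x - y"
  shows "d dvd x ^ n - y ^ n"
  using assms by (simp add: power_diff_sumr2)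

lemma fermat_little_dvd:
  fixes a :: int
  assumes "prime p"
  shows "int p dvd a ^ p - a"
proof -
  have nonneg: "int p dvd int n ^ p - int n" for n
  proof (induction n)
    case 0
    then show ?case using assms by (simp add: prime_gt_0_nat power_0_left)
  next
    case (Suc n)
    have "int p dvd ((int n + 1) ^ p - (int n ^ p + 1 ^ p)) + (int n ^ p - int n)"
      using freshmans_dream_dvd[OF assms, of "int n" 1] Suc by (intro dvd_add) auto
    then show ?case by (simp add: algebra_simps)
  qed
  define b where "b = nat (a mod int p)"
  have p: "int p > 0" using assms by (simp add: prime_gt_0_nat)
  have b: "int b = a mod int p" using p by (simp add: b_def)
  have "int p dvd a - int b" by (simp add: b)
  moreover from this have "int p dvd a ^ p - int b ^ p" by (rule dvd_diff_power)
  ultimately have "int p dvd (a ^ p - int b ^ p) + (int b ^ p - int b) - (a - int b)"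
    using nonneg[of b] by (metis dvd_add dvd_diff)
  then show ?thesis by simp
qed

lemma fermat_little_prime_power_cong:
  fixes a :: int
  assumes "prime p"
  shows "[a ^ p ^ k = a] (mod int p)"
proof (induction k)
  case (Suc k)
  have "[(a ^ p ^ k) ^ p = a ^ p ^ k] (mod int p)"
    using fermat_little_dvd[OF assms] by (simp add: cong_iff_dvd_diff)
  then have "[a ^ p ^ Suc k = a ^ p ^ k] (mod int p)"
    by (simp add: power_mult [symmetric] mult.commute)
  with Suc show ?case by (rule cong_trans[rotated])
qed simp

section \<open>Frobenius substitution in Laurent polynomials\<close>

lemma poly_mapping_sum_single:
  "F = (\<Sum>m\<in>Poly_Mapping.keys F. Poly_Mapping.single m (Poly_Mapping.lookup F m))"
  by (rule poly_mapping_eqI)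
     (simp add: lookup_sum lookup_single when_def in_keys_iff)

lemma poly_mapping_single_add_induct [case_names single add]:
  fixes F :: "'a \<Rightarrow>\<^sub>0 'b :: comm_monoid_add"
  assumes single: "\<And>m c. R (Poly_Mapping.single m c)"
    and add: "\<And>F G. R F \<Longrightarrow> R G \<Longrightarrow> R (F + G)"
  shows "R F"
proof -
  have "R (\<Sum>m\<in>A. Poly_Mapping.single m (f m))" if "finite A" for A f
    using that
  proof (induction A rule: finite_induct)
    case empty
    show ?case using single[of undefined 0] by simp
  next
    case (insert a A)
    then show ?case using single add by simp
  qed
  from this[OF finite_keys] show ?thesis
    using poly_mapping_sum_single[of F] by metis
qed

definition dilate :: "nat \<Rightarrow> (nat \<Rightarrow>\<^sub>0 int) \<Rightarrow> (nat \<Rightarrow>\<^sub>0 int)" where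
  "dilate q m = Poly_Mapping.map ((*) (int q)) m"

lemma lookup_dilate [simp]: "Poly_Mapping.lookup (dilate q m) i = int q * Poly_Mapping.lookup m i"
  by (simp add: dilate_def Poly_Mapping.map.rep_eq when_def)

lemma dilate_1 [simp]: "dilate (Suc 0) m = m"
  by (rule poly_mapping_eqI) simp

lemma single_power:
  fixes c :: "'a :: comm_ring_1"
  shows "Poly_Mapping.single m c ^ n = Poly_Mapping.single (dilate n m) (c ^ n)"
proof (induction n)
  case 0
  have "dilate 0 m = 0" by (rule poly_mapping_eqI) simp
  then show ?case by simp
next
  case (Suc n)
  have "m + dilate n m = dilate (Suc n) m"
    by (rule poly_mapping_eqI) (simp add: lookup_add algebra_simps)
  with Suc show ?case by (simp add: mult_single)
qed

text \<open>The substitution of \<open>x\<^sub>i\<^sup>q\<close> for each variable \<open>x\<^sub>i\<close>.\<close>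

definition var_power_subst ::
    "nat \<Rightarrow> ((nat \<Rightarrow>\<^sub>0 int) \<Rightarrow>\<^sub>0 int) \<Rightarrow> ((nat \<Rightarrow>\<^sub>0 int) \<Rightarrow>\<^sub>0 int)" where
  "var_power_subst q P =
     (\<Sum>m\<in>Poly_Mapping.keys P. Poly_Mapping.single (dilate q m) (Poly_Mapping.lookup P m))"

lemma of_nat_dvd_single:
  assumes "int p dvd a"
  shows "of_nat p dvd (Poly_Mapping.single m a :: (nat \<Rightarrow>\<^sub>0 int) \<Rightarrow>\<^sub>0 int)"
proof -
  obtain b where "a = int p * b" using assms by (auto elim: dvdE)
  then have "(Poly_Mapping.single m a :: (nat \<Rightarrow>\<^sub>0 int) \<Rightarrow>\<^sub>0 int)
      = Poly_Mapping.single 0 (int p) * Poly_Mapping.single m b"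
    by (simp only: mult_single add_0_left)
  also have "Poly_Mapping.single 0 (int p) = (of_nat p :: (nat \<Rightarrow>\<^sub>0 int) \<Rightarrow>\<^sub>0 int)"
    using single_of_nat[of p] by simp
  finally show ?thesis by simp
qed

lemma of_nat_dvd_lookup:
  fixes F :: "(nat \<Rightarrow>\<^sub>0 int) \<Rightarrow>\<^sub>0 int"
  assumes "of_nat p dvd F"
  shows "int p dvd Poly_Mapping.lookup F m"
proof -
  obtain H where H: "F = of_nat p * H" using assms by (auto elim: dvdE)
  have "Poly_Mapping.lookup (of_nat n * H) m = int n * Poly_Mapping.lookup H m" for n
    by (induction n) (simp_all add: lookup_add algebra_simps)
  then show ?thesis by (simp add: H)
qed

text \<open>
  Raising to the \<open>p\<close>-th power raises each monomial to the \<open>p\<close>-th power by the freshman's dream,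
  and changes no coefficient modulo \<open>p\<close> by Fermat's little theorem. For \<open>p\<^sup>k\<close> this is iterated.
\<close>

lemma power_prime_power_dvd_var_power_subst:
  assumes p: "prime p"
  shows "of_nat p dvd P ^ (p ^ k) - var_power_subst (p ^ k) P"
proof (induction k)
  case 0
  then show ?case using poly_mapping_sum_single[of P] by (simp add: var_power_subst_def)
next
  case (Suc k)
  let ?K = "Poly_Mapping.keys P" and ?c = "Poly_Mapping.lookup P"
  let ?q = "p ^ k"
  have dil: "dilate p (dilate ?q m) = dilate (p ^ Suc k) m" for m
    by (rule poly_mapping_eqI) simp
  have 1: "of_nat p dvd (P ^ ?q) ^ p - var_power_subst ?q P ^ p"
    by (rule dvd_diff_power[OF Suc])
  have 2: "of_nat p dvd var_power_subst ?q P ^ p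
      - (\<Sum>m\<in>?K. Poly_Mapping.single (dilate ?q m) (?c m) ^ p)"
    unfolding var_power_subst_def by (rule freshmans_dream_sum_dvd[OF p finite_keys])
  have "of_nat p dvd (\<Sum>m\<in>?K. Poly_Mapping.single (dilate (p ^ Suc k) m) (?c m ^ p - ?c m))"
    by (intro dvd_sum of_nat_dvd_single fermat_little_dvd[OF p])
  then have 3: "of_nat p dvd (\<Sum>m\<in>?K. Poly_Mapping.single (dilate ?q m) (?c m) ^ p)
      - var_power_subst (p ^ Suc k) P"
    by (simp only: single_power dil single_diff sum_subtractf var_power_subst_def)
  have "(P ^ ?q) ^ p = P ^ (p ^ Suc k)"
    by (simp add: power_mult [symmetric] mult.commute)
  with dvd_add[OF dvd_add[OF 1 2] 3] show ?case by simp
qed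

text \<open>
  A monomial of \<open>Q\<close> whose product with a monomial in the \<open>q\<close>-th powers is constant has all its
  exponents divisible by \<open>q\<close>. Exponents below \<open>q\<close> in absolute value must then vanish.
\<close>

lemma lookup_0_var_power_subst_mult:
  fixes P Q :: "(nat \<Rightarrow>\<^sub>0 int) \<Rightarrow>\<^sub>0 int"
  assumes bound: "\<And>m i. m \<in> Poly_Mapping.keys Q \<Longrightarrow> \<bar>Poly_Mapping.lookup m i\<bar> < int q"
  shows "Poly_Mapping.lookup (var_power_subst q P * Q) 0
       = Poly_Mapping.lookup P 0 * Poly_Mapping.lookup Q 0"
proof -
  let ?c = "Poly_Mapping.lookup P" and ?d = "Poly_Mapping.lookup Q"
  let ?K = "Poly_Mapping.keys P" and ?L = "Poly_Mapping.keys Q"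
  have cancel: "m = 0 \<and> l = 0" if l: "l \<in> ?L" and eq: "dilate q m + l = 0" for m l
  proof -
    have "Poly_Mapping.lookup m i = 0 \<and> Poly_Mapping.lookup l i = 0" for i
    proof -
      have "Poly_Mapping.lookup (dilate q m + l) i = 0" using eq by simp
      then have e: "Poly_Mapping.lookup l i = - (int q * Poly_Mapping.lookup m i)"
        by (simp add: lookup_add)
      then have "int q dvd Poly_Mapping.lookup l i" by simp
      with bound[OF l, of i] have "Poly_Mapping.lookup l i = 0"
        using dvd_imp_le_int by force
      moreover have "q \<noteq> 0" using bound[OF l, of i] by auto
      ultimately show ?thesis using e by simp
    qed
    then show ?thesis by (auto intro!: poly_mapping_eqI)
  qed
  have "var_power_subst q P * Q
      = (\<Sum>m\<in>?K. \<Sum>l\<in>?L. Poly_Mapping.single (dilate q m + l) (?c m * ?d l))"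
    by (subst poly_mapping_sum_single[of Q])
       (simp only: var_power_subst_def sum_product mult_single)
  then have "Poly_Mapping.lookup (var_power_subst q P * Q) 0
      = (\<Sum>m\<in>?K. \<Sum>l\<in>?L. (?c m * ?d l when dilate q m + l = 0))"
    by (simp only: lookup_sum lookup_single)
  also have "\<dots> = (\<Sum>m\<in>?K. \<Sum>l\<in>?L. if m = 0 then (if l = 0 then ?c 0 * ?d 0 else 0) else 0)"
  proof (intro sum.cong refl)
    fix m l assume "l \<in> ?L"
    moreover have "dilate q 0 = 0" by (rule poly_mapping_eqI) simp
    ultimately show "(?c m * ?d l when dilate q m + l = 0)
        = (if m = 0 then (if l = 0 then ?c 0 * ?d 0 else 0) else 0)"
      using cancel[of l m] by (auto simp: when_def)
  qed
  also have "\<dots> = (\<Sum>m\<in>?K. if m = 0 then ?c 0 * ?d 0 else 0)"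
    by (intro sum.cong refl) (auto simp: in_keys_iff)
  also have "\<dots> = ?c 0 * ?d 0"
    by (auto simp: in_keys_iff)
  finally show ?thesis .
qed

lemma keys_exponents_bounded:
  fixes Q :: "(nat \<Rightarrow>\<^sub>0 int) \<Rightarrow>\<^sub>0 int"
  obtains B where "\<And>m i. m \<in> Poly_Mapping.keys Q \<Longrightarrow> \<bar>Poly_Mapping.lookup m i\<bar> < int B"
proof -
  let ?E = "insert 0 (\<Union>m\<in>Poly_Mapping.keys Q.
              (\<lambda>i. nat \<bar>Poly_Mapping.lookup m i\<bar>) ` Poly_Mapping.keys m)"
  have fin: "finite ?E" by simp
  have "\<bar>Poly_Mapping.lookup m i\<bar> < int (Suc (Max ?E))" if "m \<in> Poly_Mapping.keys Q" for m i
  proof -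
    have "nat \<bar>Poly_Mapping.lookup m i\<bar> \<in> ?E"
    proof (cases "i \<in> Poly_Mapping.keys m")
      case True
      with that show ?thesis by blast
    next
      case False
      then show ?thesis by (simp add: in_keys_iff)
    qed
    then have "nat \<bar>Poly_Mapping.lookup m i\<bar> \<le> Max ?E" using fin by (rule Max_ge[rotated])
    then show ?thesis by linarith
  qed
  then show ?thesis by (rule that)
qed

lemma ct_power_prime_cong:
  fixes P Q :: "(nat \<Rightarrow>\<^sub>0 int) \<Rightarrow>\<^sub>0 int"
  assumes p: "prime p" and k: "k > 0"
    and bound: "\<And>m i. m \<in> Poly_Mapping.keys Q \<Longrightarrow> \<bar>Poly_Mapping.lookup m i\<bar> < int p"
  shows "[Poly_Mapping.lookup (P ^ (p ^ k) * Q) 0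
          = Poly_Mapping.lookup P 0 * Poly_Mapping.lookup Q 0] (mod int p)"
proof -
  have "p \<le> p ^ k" using k p by (intro self_le_power prime_ge_1_nat)
  then have "\<bar>Poly_Mapping.lookup m i\<bar> < int (p ^ k)" if "m \<in> Poly_Mapping.keys Q" for m i
    using bound[OF that, of i] by linarith
  then have *: "Poly_Mapping.lookup (var_power_subst (p ^ k) P * Q) 0
       = Poly_Mapping.lookup P 0 * Poly_Mapping.lookup Q 0"
    by (rule lookup_0_var_power_subst_mult)
  have "of_nat p dvd (P ^ (p ^ k) - var_power_subst (p ^ k) P) * Q"
    using power_prime_power_dvd_var_power_subst[OF p] by (rule dvd_mult2)
  then have "int p dvd Poly_Mapping.lookup (P ^ (p ^ k) * Q - var_power_subst (p ^ k) P * Q) 0"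
    by (intro of_nat_dvd_lookup) (simp add: left_diff_distrib)
  then show ?thesis by (simp add: * lookup_minus cong_iff_dvd_diff)
qed

section \<open>Clearing denominators\<close>

abbreviation rat_coeffs :: "((nat \<Rightarrow>\<^sub>0 int) \<Rightarrow>\<^sub>0 int) \<Rightarrow> laurent" where
  "rat_coeffs \<equiv> Poly_Mapping.map of_int"

lemma lookup_rat_coeffs:
  "Poly_Mapping.lookup (rat_coeffs F) m = of_int (Poly_Mapping.lookup F m)"
  by (simp add: Poly_Mapping.map.rep_eq when_def)

lemma rat_coeffs_add: "rat_coeffs (F + G) = rat_coeffs F + rat_coeffs G"
  by (rule poly_mapping_eqI) (simp add: lookup_rat_coeffs lookup_add)

lemma rat_coeffs_mult: "rat_coeffs (F * G) = rat_coeffs F * rat_coeffs G"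
proof (induction F rule: poly_mapping_single_add_induct)
  case (single m c)
  show ?case
    by (induction G rule: poly_mapping_single_add_induct)
       (simp_all add: mult_single rat_coeffs_add distrib_left)
next
  case (add F G)
  then show ?case by (simp add: rat_coeffs_add distrib_right)
qed

lemma rat_coeffs_power: "rat_coeffs (F ^ n) = rat_coeffs F ^ n"
proof (induction n)
  case 0
  have "rat_coeffs (Poly_Mapping.single 0 1) = Poly_Mapping.single 0 (of_int 1)"
    by (rule map_single) simp
  then show ?case by (simp only: single_one power_0 of_int_1)
next
  case (Suc n)
  then show ?case by (simp add: rat_coeffs_mult)
qed

lemma clear_denominators:
  fixes P :: laurent
  obtains M :: int and P' where "M \<noteq> 0" "rat_coeffs P' = Poly_Mapping.single 0 (of_int M) * P"
proof -
  have "\<exists>M::int. \<exists>P'. M \<noteq> 0 \<and> rat_coeffs P' = Poly_Mapping.single 0 (of_int M) * P"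
  proof (induction P rule: poly_mapping_single_add_induct)
    case (single m c)
    obtain a b where c: "c = of_int a / of_int b" and "b > 0"
      by (metis quotient_of_div quotient_of_denom_pos surj_pair)
    then have "rat_coeffs (Poly_Mapping.single m a)
        = Poly_Mapping.single 0 (of_int b) * Poly_Mapping.single m c"
      by (simp add: mult_single del: single_of_int)
    with \<open>b > 0\<close> show ?case by (metis less_irrefl)
  next
    case (add F G)
    then obtain M N :: int and F' G' where nz: "M \<noteq> 0" "N \<noteq> 0"
      and F: "rat_coeffs F' = Poly_Mapping.single 0 (of_int M) * F"
      and G: "rat_coeffs G' = Poly_Mapping.single 0 (of_int N) * G"
      by blast
    have "rat_coeffs (Poly_Mapping.single 0 N * F' + Poly_Mapping.single 0 M * G')
        = Poly_Mapping.single 0 (of_int N) * (Poly_Mapping.single 0 (of_int M) * F)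
          + Poly_Mapping.single 0 (of_int M) * (Poly_Mapping.single 0 (of_int N) * G)"
      unfolding rat_coeffs_add rat_coeffs_mult F G by (simp del: single_of_int)
    also have "\<dots> = Poly_Mapping.single 0 (of_int (M * N)) * (F + G)"
      unfolding single_of_int by (simp add: algebra_simps)
    finally show ?case using nz by (metis mult_eq_0_iff)
  qed
  then show ?thesis using that by blast
qed

lemma ct_of_int_mult: "ct (of_int a * F) = of_int a * ct F"
proof -
  have "of_int a * F = Poly_Mapping.map ((*) (of_int a)) F"
    by (simp add: mult_map_scale_conv_mult)
  then show ?thesis by (simp add: ct_def Poly_Mapping.map.rep_eq when_def)
qed

text \<open>
  The fractions \<open>A(p\<^sup>k) = u/w\<close> are congruent modulo \<open>p\<close> to \<open>C/N\<close>, which depends neither on \<open>k\<close> nor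
  on \<open>p\<close>. The denominator \<open>N\<close> is the product of common denominators \<open>M\<^sub>P\<close> of \<open>P\<close> and \<open>M\<^sub>Q\<close> of
  \<open>Q\<close>: the denominator \<open>M\<^sub>P\<^sup>q M\<^sub>Q\<close> of \<open>A(q)\<close> reduces to it by Fermat's little theorem.
\<close>

lemma constant_term_seq_cong:
  assumes "constant_term_seq A"
  obtains N C :: int and B :: nat where "N \<noteq> 0"
    "\<And>p k u w. prime p \<Longrightarrow> B < p \<Longrightarrow> k > 0 \<Longrightarrow> A (p ^ k) * of_int w = of_int u
        \<Longrightarrow> [N * u = C * w] (mod int p)"
proof -
  obtain P Q where A: "\<And>n. A n = ct (P ^ n * Q)"
    using assms by (auto simp: constant_term_seq_def)
  obtain M P' where M: "M \<noteq> 0" "rat_coeffs P' = Poly_Mapping.single 0 (of_int M) * P"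
    by (rule clear_denominators)
  obtain L Q' where L: "L \<noteq> 0" "rat_coeffs Q' = Poly_Mapping.single 0 (of_int L) * Q"
    by (rule clear_denominators)
  obtain B where B: "\<And>m i. m \<in> Poly_Mapping.keys Q' \<Longrightarrow> \<bar>Poly_Mapping.lookup m i\<bar> < int B"
    using keys_exponents_bounded[of Q'] by blast
  let ?C = "Poly_Mapping.lookup P' 0 * Poly_Mapping.lookup Q' 0"
  have scaled: "of_int (Poly_Mapping.lookup (P' ^ n * Q') 0) = of_int (M ^ n * L) * A n" for n
  proof -
    have "rat_coeffs (P' ^ n * Q') = of_int (M ^ n * L) * (P ^ n * Q)"
      by (simp add: rat_coeffs_mult rat_coeffs_power M L power_mult_distrib mult_ac)
    then show ?thesis
      by (metis A ct_def ct_of_int_mult lookup_rat_coeffs)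
  qed
  show ?thesis
  proof (rule that[of "M * L" B ?C])
    show "M * L \<noteq> 0" using M L by simp
    fix p k :: nat and u w :: int
    assume p: "prime p" "B < p" "k > 0" and uw: "A (p ^ k) * of_int w = of_int u"
    let ?t = "Poly_Mapping.lookup (P' ^ (p ^ k) * Q') 0"
    have "(of_int (M ^ (p ^ k) * L * u) :: rat) = of_int (M ^ (p ^ k) * L) * A (p ^ k) * of_int w"
      by (simp add: uw [symmetric])
    also have "\<dots> = of_int (?t * w)" using scaled[of "p ^ k"] by simp
    finally have eq: "M ^ (p ^ k) * L * u = ?t * w" by (simp only: of_int_eq_iff)
    have "[M * L * u = M ^ (p ^ k) * L * u] (mod int p)"
      by (intro cong_mult cong_refl cong_sym[OF fermat_little_prime_power_cong[OF p(1)]])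
    also have "M ^ (p ^ k) * L * u = ?t * w" by (rule eq)
    also have "[?t * w = ?C * w] (mod int p)"
    proof (intro cong_mult cong_refl ct_power_prime_cong p)
      fix m i assume "m \<in> Poly_Mapping.keys Q'"
      from B[OF this, of i] p(2) show "\<bar>Poly_Mapping.lookup m i\<bar> < int p" by linarith
    qed
    finally show "[M * L * u = ?C * w] (mod int p)" .
  qed
qed

section \<open>Products over arithmetic progressions of difference 9\<close>

definition progression_prod :: "int \<Rightarrow> nat \<Rightarrow> int" where
  "progression_prod c n = (\<Prod>j<n. c + 9 * int j)"

lemma progression_prod_add:
  "progression_prod c (m + n) = progression_prod c m * progression_prod (c + 9 * int m) n"
  by (induction n) (simp_all add: progression_prod_def algebra_simps)

lemma progression_prod_1 [simp]: "progression_prod c (Suc 0) = c"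
  by (simp add: progression_prod_def)

lemma progression_prod_pos: "c > 0 \<Longrightarrow> progression_prod c n > 0"
  by (auto simp: progression_prod_def intro!: prod_pos)

lemma pochhammer_eq_progression_prod:
  "pochhammer (of_int c / 9 :: rat) n = of_int (progression_prod c n) / 9 ^ n"
  by (induction n)
     (simp_all add: progression_prod_def pochhammer_Suc field_simps)

text \<open>
  As \<open>p\<close> is coprime to the difference \<open>9\<close>, the \<open>p\<close> factors form a complete residue system. The
  one at \<open>j\<^sub>0\<close> is the multiple of \<open>p\<close>, and Wilson's theorem evaluates the product of the others.
\<close>

lemma progression_prod_prime:
  assumes p: "prime p" and p9: "coprime (int p) 9"
    and j0: "j0 < p" "c + 9 * int j0 = int p * c'"
  obtains R where "progression_prod c p = int p * c' * R" "[R = -1] (mod int p)"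
proof -
  let ?f = "\<lambda>j. c + 9 * int j" and ?J = "{..<p} - {j0}"
  define g where "g j = nat (?f j mod int p)" for j
  have p0: "p > 0" using p by (simp add: prime_gt_0_nat)
  have g: "int (g j) = ?f j mod int p" for j using p0 by (simp add: g_def)
  have inj: "inj_on g {..<p}"
  proof (rule inj_onI)
    fix i j assume ij: "i \<in> {..<p}" "j \<in> {..<p}" "g i = g j"
    then have "[?f i = ?f j] (mod int p)" using g by (metis cong_def)
    then have "[9 * int i = 9 * int j] (mod int p)" by (simp add: cong_add_lcancel)
    then have "[int i = int j] (mod int p)"
      using p9 by (simp add: cong_mult_lcancel coprime_commute)
    then show "i = j" using ij by (auto simp: cong_int_iff cong_def)
  qed
  have g0: "g j0 = 0" by (simp add: g_def j0)
  have "g ` ?J \<subseteq> {1..p - 1}"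
  proof
    fix x assume "x \<in> g ` ?J"
    then obtain j where j: "j < p" "j \<noteq> j0" "x = g j" by auto
    have "g j \<noteq> g j0" using inj j j0(1) by (auto dest: inj_onD)
    moreover have "int (g j) < int p" using g p0 by simp
    ultimately show "x \<in> {1..p - 1}" using g0 j by auto
  qed
  moreover have inj': "inj_on g ?J" using inj by (rule inj_on_subset) auto
  then have "card (g ` ?J) = card {1..p - 1}" using j0(1) by (simp add: card_image)
  ultimately have image: "g ` ?J = {1..p - 1}" by (intro card_subset_eq) auto
  have "[prod ?f ?J = (\<Prod>j\<in>?J. int (g j))] (mod int p)"
    by (intro cong_prod) (simp add: g cong_def)
  also have "(\<Prod>j\<in>?J. int (g j)) = (\<Prod>x\<in>{1..p - 1}. int x)"
    unfolding image[symmetric] by (rule prod.reindex[OF inj', symmetric, unfolded o_def])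
  also have "\<dots> = fact (p - 1)" by (simp add: fact_prod)
  also have "[fact (p - 1) = -1] (mod int p)" using wilson_theorem[OF p] .
  finally have R: "[prod ?f ?J = -1] (mod int p)" .
  have "progression_prod c p = ?f j0 * prod ?f ?J"
    unfolding progression_prod_def using j0(1) by (intro prod.remove) auto
  with j0(2) R show ?thesis by (intro that) auto
qed

text \<open>
  Since \<open>c\<close> and \<open>c'\<close> lie between \<open>1\<close> and \<open>9\<close> and \<open>p > 9\<close>, the term \<open>p c'\<close> of the progression
  is among the first \<open>p\<close> ones. The multiples of \<open>p\<close> in the successive blocks of length \<open>p\<close> are
  then \<open>p c', p (c' + 9), p (c' + 18), \<dots>\<close>: dividing by \<open>p\<close> gives the progression starting at \<open>c'\<close>.
\<close>

lemma progression_prod_prime_mult: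
  assumes p: "prime p" "p > 9"
    and c: "1 \<le> c" "c \<le> 9" "1 \<le> c'" "c' \<le> 9" "[int p * c' = c] (mod 9)"
  obtains R where "progression_prod c (p * n) = int p ^ n * progression_prod c' n * R"
    "[R = (-1) ^ n] (mod int p)"
proof -
  have "\<not> p dvd 3"
    using p(2) by (auto dest: dvd_imp_le)
  then have "coprime p 3" using p(1) prime_imp_coprime by blast
  then have "coprime (int p) (int 3)" by (simp only: coprime_int_iff)
  then have "coprime (int p) (3 ^ 2)" by (simp only: coprime_power_right_iff of_nat_numeral) simp
  then have p9: "coprime (int p) 9" by simp
  obtain j where j: "int p * c' - c = 9 * j"
    using c(5) by (auto simp: cong_iff_dvd_diff elim: dvdE)
  have "int p * 1 \<le> int p * c'" "int p * c' \<le> int p * 9"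
    using c p by (auto intro: mult_left_mono)
  with j c p have "0 \<le> j" "j < int p" by linarith+
  then obtain j0 where j0: "j = int j0" "j0 < p"
    by (metis nonneg_int_cases of_nat_less_iff)
  have "\<exists>R. progression_prod c (p * n) = int p ^ n * progression_prod c' n * R
      \<and> [R = (-1) ^ n] (mod int p)"
  proof (induction n)
    case 0
    then show ?case by (auto simp: progression_prod_def)
  next
    case (Suc n)
    then obtain R where R: "progression_prod c (p * n) = int p ^ n * progression_prod c' n * R"
      "[R = (-1) ^ n] (mod int p)" by blast
    have "c + 9 * int (p * n) + 9 * int j0 = int p * (c' + 9 * int n)"
      using j j0 by (simp add: algebra_simps)
    then obtain S where
      S: "progression_prod (c + 9 * int (p * n)) p = int p * (c' + 9 * int n) * S"
        "[S = -1] (mod int p)"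
      by (rule progression_prod_prime[OF p(1) p9 j0(2)])
    have "progression_prod c (p * Suc n)
        = progression_prod c (p * n) * progression_prod (c + 9 * int (p * n)) p"
      using progression_prod_add[of c "p * n" p] by (simp add: add.commute)
    also have "\<dots> = int p ^ Suc n * progression_prod c' (Suc n) * (S * R)"
      using R S by (simp add: progression_prod_def mult_ac)
    finally show ?case using cong_mult[OF S(2) R(2)] by auto
  qed
  then show ?thesis using that by blast
qed

lemma progression_prod_prime_square:
  assumes p: "prime p" "p > 9"
    and c: "1 \<le> c" "c \<le> 9" "1 \<le> c'" "c' \<le> 9" "[int p * c' = c] (mod 9)"
    and c': "1 \<le> c''" "c'' \<le> 9" "[int p * c'' = c'] (mod 9)"
  obtains R where "progression_prod c (p * p) = int p ^ Suc p * c'' * R"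
    "[R = (-1) ^ Suc p] (mod int p)"
proof -
  obtain R where R: "progression_prod c (p * p) = int p ^ p * progression_prod c' p * R"
    "[R = (-1) ^ p] (mod int p)"
    by (rule progression_prod_prime_mult[OF p c])
  obtain S where S: "progression_prod c' (p * 1) = int p ^ 1 * progression_prod c'' 1 * S"
    "[S = (-1) ^ 1] (mod int p)"
    by (rule progression_prod_prime_mult[OF p c(3,4) c'])
  have "progression_prod c (p * p) = int p ^ Suc p * c'' * (S * R)"
    using R S by (simp add: mult_ac)
  moreover have "[S * R = (-1) ^ Suc p] (mod int p)"
    using cong_mult[OF S(2) R(2)] by simp
  ultimately show ?thesis by (rule that)
qed

section \<open>The hypergeometric sequence modulo primes\<close>

abbreviation hypergeom :: "nat \<Rightarrow> rat" where
  "hypergeom n \<equiv> (pochhammer (1/9 :: rat) n * pochhammer (4/9) n * pochhammer (5/9) n)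
        / ((fact n)^2 * pochhammer (1/3) n)"

text \<open>
  Writing \<open>n!\<close> as the rising factorial of \<open>9/9\<close> and \<open>1/3\<close> as \<open>3/9\<close> brings all factors to the
  common difference \<open>9\<close>. There are three of them above and below, so the powers of \<open>9\<close> cancel.
\<close>

lemma hypergeom_eq_progression_prods:
  "hypergeom n = of_int (progression_prod 1 n * progression_prod 4 n * progression_prod 5 n)
     / of_int (progression_prod 9 n ^ 2 * progression_prod 3 n)"
proof -
  have eqs: "(fact n :: rat) = of_int (progression_prod 9 n) / 9 ^ n"
    "pochhammer (1/3 :: rat) n = of_int (progression_prod 3 n) / 9 ^ n"
    "pochhammer (1/9 :: rat) n = of_int (progression_prod 1 n) / 9 ^ n"
    "pochhammer (4/9 :: rat) n = of_int (progression_prod 4 n) / 9 ^ n"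
    "pochhammer (5/9 :: rat) n = of_int (progression_prod 5 n) / 9 ^ n"
    using pochhammer_eq_progression_prod[of 9 n] pochhammer_eq_progression_prod[of 3 n]
      pochhammer_eq_progression_prod[of 1 n] pochhammer_eq_progression_prod[of 4 n]
      pochhammer_eq_progression_prod[of 5 n]
    by (simp_all add: pochhammer_fact)
  have "progression_prod 9 n \<noteq> 0" "progression_prod 3 n \<noteq> 0"
    using progression_prod_pos[of 9 n] progression_prod_pos[of 3 n] by simp_all
  then show ?thesis
    unfolding eqs by (simp add: field_simps power2_eq_square)
qed

text \<open>
  When all five products have the same power of \<open>p\<close> as a factor and the same unit \<open>s\<close> modulo \<open>p\<close>
  in their cofactors, both drop out of the quotient, which is then
  \<open>d\<^sub>1 d\<^sub>4 d\<^sub>5 / (d\<^sub>9\<^sup>2 d\<^sub>3)\<close> modulo \<open>p\<close>.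
\<close>

lemma hypergeom_cong:
  fixes N C s :: int and d :: "int \<Rightarrow> int"
  assumes p: "p > 0" and s: "coprime s (int p)"
    and prods: "\<And>c. c \<in> {1, 3, 4, 5, 9} \<Longrightarrow>
        \<exists>R. progression_prod c n = int p ^ e * d c * R \<and> [R = s] (mod int p)"
    and cong: "\<And>u w. hypergeom n * of_int w = of_int u \<Longrightarrow> [N * u = C * w] (mod int p)"
  shows "[N * (d 1 * d 4 * d 5) = C * (d 9 ^ 2 * d 3)] (mod int p)"
proof -
  obtain R where R: "\<And>c. c \<in> {1, 3, 4, 5, 9} \<Longrightarrow>
      progression_prod c n = int p ^ e * d c * R c \<and> [R c = s] (mod int p)"
    using prods by metis
  define u w where "u = d 1 * d 4 * d 5 * (R 1 * R 4 * R 5)"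
    and "w = d 9 ^ 2 * d 3 * (R 9 ^ 2 * R 3)"
  have num: "progression_prod 1 n * progression_prod 4 n * progression_prod 5 n
      = (int p ^ e) ^ 3 * u"
    using R[of 1] R[of 4] R[of 5] by (simp add: u_def power3_eq_cube mult_ac)
  have den: "progression_prod 9 n ^ 2 * progression_prod 3 n = (int p ^ e) ^ 3 * w"
    using R[of 9] R[of 3] by (simp add: w_def power3_eq_cube power2_eq_square mult_ac)
  have "progression_prod 9 n ^ 2 * progression_prod 3 n \<noteq> 0"
    using progression_prod_pos[of 9 n] progression_prod_pos[of 3 n] by simp
  then have "w \<noteq> 0" using den by auto
  then have "hypergeom n * of_int w = of_int u"
    unfolding hypergeom_eq_progression_prods num den using p by simp
  then have "[N * u = C * w] (mod int p)" by (rule cong)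
  moreover have "[u = d 1 * d 4 * d 5 * (s * s * s)] (mod int p)"
    unfolding u_def using R by (intro cong_mult cong_refl) auto
  moreover have "[w = d 9 ^ 2 * d 3 * (s ^ 2 * s)] (mod int p)"
    unfolding w_def using R by (intro cong_mult cong_pow cong_refl) auto
  ultimately have "[N * (d 1 * d 4 * d 5 * (s * s * s)) = C * (d 9 ^ 2 * d 3 * (s ^ 2 * s))]
      (mod int p)"
    by (meson cong_scalar_left cong_sym cong_trans)
  then have "[s ^ 3 * (N * (d 1 * d 4 * d 5)) = s ^ 3 * (C * (d 9 ^ 2 * d 3))] (mod int p)"
    by (simp add: power3_eq_cube power2_eq_square mult_ac)
  then show ?thesis using s by (simp add: cong_mult_lcancel)
qed

text \<open>
  The congruences for \<open>A(p)\<close> and \<open>A(p\<^sup>2)\<close> share the value \<open>C/N\<close>. Cross-multiplying eliminates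
  \<open>C\<close>, which leaves \<open>p\<close> dividing \<open>N\<close> times a number that is bounded independently of \<open>p\<close>.
\<close>

lemma prime_dvd_cross_difference:
  fixes N C :: int and d d' :: "int \<Rightarrow> int"
  assumes p: "prime p" "p > 9"
    and cong: "\<And>k u w. k > 0 \<Longrightarrow> hypergeom (p ^ k) * of_int w = of_int u
                 \<Longrightarrow> [N * u = C * w] (mod int p)"
    and d: "\<And>c. c \<in> {1, 3, 4, 5, 9} \<Longrightarrow> 1 \<le> d c \<and> d c \<le> 9 \<and> [int p * d c = c] (mod 9)"
    and d': "\<And>c. c \<in> {1, 3, 4, 5, 9} \<Longrightarrow> 1 \<le> d' c \<and> d' c \<le> 9 \<and> [int p * d' c = d c] (mod 9)"
  shows "int p dvd N * (d 1 * d 4 * d 5 * (d' 9 ^ 2 * d' 3) - d' 1 * d' 4 * d' 5 * (d 9 ^ 2 * d 3))"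
proof -
  have p0: "p > 0" using p by simp
  have 1: "[N * (d 1 * d 4 * d 5) = C * (d 9 ^ 2 * d 3)] (mod int p)"
  proof (rule hypergeom_cong[where n = p and e = 1 and s = "-1"])
    fix c :: int assume c: "c \<in> {1, 3, 4, 5, 9}"
    then have c9: "1 \<le> c" "c \<le> 9" by auto
    obtain R where "progression_prod c (p * 1) = int p ^ 1 * progression_prod (d c) 1 * R"
      "[R = (-1) ^ 1] (mod int p)"
      using d[OF c] by (elim conjE) (rule progression_prod_prime_mult[OF p c9])
    then show "\<exists>R. progression_prod c p = int p ^ 1 * d c * R \<and> [R = -1] (mod int p)"
      by auto
  qed (use p0 cong[of 1] in auto)
  have 2: "[N * (d' 1 * d' 4 * d' 5) = C * (d' 9 ^ 2 * d' 3)] (mod int p)"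
  proof (rule hypergeom_cong[where n = "p * p" and e = "Suc p" and s = "(-1) ^ Suc p"])
    fix c :: int assume c: "c \<in> {1, 3, 4, 5, 9}"
    then have c9: "1 \<le> c" "c \<le> 9" by auto
    show "\<exists>R. progression_prod c (p * p) = int p ^ Suc p * d' c * R
        \<and> [R = (-1) ^ Suc p] (mod int p)"
      using d[OF c] d'[OF c] progression_prod_prime_square[OF p c9] by metis
  next
    show "coprime ((-1) ^ Suc p) (int p)" by (simp only: coprime_power_left_iff) simp
  qed (use p0 cong[of 2] in \<open>auto simp: power2_eq_square\<close>)
  let ?D = "d 9 ^ 2 * d 3" and ?D' = "d' 9 ^ 2 * d' 3"
  have "[N * (d 1 * d 4 * d 5) * ?D' - N * (d' 1 * d' 4 * d' 5) * ?D
      = C * ?D * ?D' - C * ?D' * ?D] (mod int p)"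
    by (intro cong_diff cong_mult 1 2 cong_refl)
  then have "[N * (d 1 * d 4 * d 5) * ?D' - N * (d' 1 * d' 4 * d' 5) * ?D = 0] (mod int p)"
    by (simp add: mult_ac)
  then show ?thesis by (simp add: cong_0_iff algebra_simps)
qed

text \<open>
  With \<open>r\<close> the inverse of \<open>p\<close> modulo \<open>9\<close>, the prime operation is multiplication by \<open>r\<close> on
  residues, where the residue \<open>0\<close> is represented by \<open>9\<close>.
\<close>

lemma hypergeom_not_cong:
  fixes N C :: int
  assumes p: "prime p" "p > 9" "p mod 3 = 2" and N: "\<not> int p dvd N"
    and cong: "\<And>k u w. k > 0 \<Longrightarrow> hypergeom (p ^ k) * of_int w = of_int u
                 \<Longrightarrow> [N * u = C * w] (mod int p)"
  shows False
proof -
  define r where "r = (if p mod 9 = 2 then 5 else if p mod 9 = 5 then 2 else 8 :: int)"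
  define d where "d c = (if c = 9 then 9 else r * c mod 9)" for c
  have "p mod 9 = 2 \<or> p mod 9 = 5 \<or> p mod 9 = 8" using p(3) by presburger
  then have pr: "int p mod 9 = 2 \<and> r = 5 \<or> int p mod 9 = 5 \<and> r = 2 \<or> int p mod 9 = 8 \<and> r = 8"
    using zmod_int[of p 9] by (auto simp: r_def)
  have inverse: "[int p * d c = c] (mod 9)" for c
  proof -
    have "[int p * r = 1] (mod 9)"
      using pr by (auto simp: cong_def mod_mult_left_eq [symmetric, of "int p"])
    then have "[int p * (r * c) = c] (mod 9)"
      using cong_scalar_right[of "int p * r" 1 9 c] by (simp add: mult_ac)
    then show ?thesis
      by (auto simp: d_def cong_def mod_mult_right_eq)
  qed
  have d_values: "c \<in> {1, 3, 4, 5, 9} \<Longrightarrow> 1 \<le> d c \<and> d c \<le> 9 \<and> 1 \<le> d (d c) \<and> d (d c) \<le> 9" for c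
    using pr by (auto simp: d_def)
  have "int p dvd N * (d 1 * d 4 * d 5 * (d (d 9) ^ 2 * d (d 3))
      - d (d 1) * d (d 4) * d (d 5) * (d 9 ^ 2 * d 3))"
    using d_values inverse by (intro prime_dvd_cross_difference[OF p(1,2) cong]) auto
  then have "int p dvd d 1 * d 4 * d 5 * (d (d 9) ^ 2 * d (d 3))
      - d (d 1) * d (d 4) * d (d 5) * (d 9 ^ 2 * d 3)"
    using N p(1) by (simp add: prime_dvd_mult_iff)
  \<comment> \<open>The differences for \<open>p\<close> congruent to 2, 5, 8 modulo 9 are -126, -288, 360, up to the
      factor \<open>9\<^sup>2\<close> from \<open>c = 9\<close>; the next step takes a common multiple with small prime factors.\<close>
  then have "int p dvd 81 * 126 \<or> int p dvd 81 * 288 \<or> int p dvd 81 * 360"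
    using pr by (auto simp: d_def)
  then have "int p dvd int (2 ^ 5 * 3 ^ 8 * 5 * 7)"
    by (elim disjE) (erule dvd_trans, simp)+
  then have "p dvd 2 ^ 5 * 3 ^ 8 * 5 * 7"
    by (simp only: int_dvd_int_iff)
  then have "p dvd 2 \<or> p dvd 3 \<or> p dvd 5 \<or> p dvd 7"
    unfolding prime_dvd_mult_iff[OF p(1)] using prime_dvd_power[OF p(1)] by blast
  then show False using p(2) by (auto dest: dvd_imp_le)
qed

section \<open>Primes congruent to 2 modulo 3\<close>

text \<open>
  Residues \<open>1\<close> modulo \<open>3\<close> are closed under multiplication, so some prime factor must have another
  residue; Euclid's argument applied to \<open>3 B! - 1\<close> then gives infinitely many such primes.
\<close>

lemma exists_prime_factor_2_mod_3:
  fixes n :: nat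
  assumes "n mod 3 = 2"
  shows "\<exists>p. prime p \<and> p dvd n \<and> p mod 3 = 2"
  using assms
proof (induction n rule: less_induct)
  case (less n)
  then have "n \<noteq> 1" "n \<noteq> 0" by auto
  then obtain q where q: "prime q" "q dvd n" using prime_factor_nat by blast
  then obtain m where m: "n = q * m" by (auto elim: dvdE)
  have "q mod 3 < 3" by simp
  then consider "q mod 3 = 0" | "q mod 3 = 1" | "q mod 3 = 2" by linarith
  then show ?case
  proof cases
    case 1
    then have "n mod 3 = 0" using m by auto
    with less.prems show ?thesis by simp
  next
    case 2
    then have "m mod 3 = 2" using less.prems m by (metis mod_mult_left_eq mult_1)
    moreover have "m < n" using m \<open>n \<noteq> 0\<close> prime_gt_1_nat[OF q(1)] by simp
    ultimately show ?thesis using less.IH m by (metis dvd_mult)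
  next
    case 3
    with q show ?thesis by blast
  qed
qed

lemma primes_2_mod_3_unbounded:
  obtains p :: nat where "prime p" "p > B" "p mod 3 = 2"
proof -
  define f where "f = (fact B :: nat)"
  have f: "f \<ge> 1" unfolding f_def by (rule fact_ge_1)
  then have "3 * f - 1 = 2 + 3 * (f - 1)" by linarith
  then have "(3 * f - 1) mod 3 = 2" by (simp only: mod_mult_self2) simp
  then obtain p where p: "prime p" "p dvd 3 * f - 1" "p mod 3 = 2"
    using exists_prime_factor_2_mod_3 by blast
  have "p > B"
  proof (rule ccontr)
    assume "\<not> p > B"
    then have "p dvd f" using prime_dvd_fact_iff[OF p(1)] by (simp add: f_def)
    then have "p dvd 3 * f" by (rule dvd_mult)
    then have "p dvd 3 * f - (3 * f - 1)" using p(2) by (rule dvd_diff_nat)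
    moreover have "3 * f - (3 * f - 1) = 1" using f by simp
    ultimately have "p dvd 1" by simp
    with p(1) show False by simp
  qed
  with p(1) show ?thesis using p(3) by (rule that)
qed

section \<open>The sequence is not a constant term sequence\<close>

theorem lemma6p6:
  "\<not> constant_term_seq (\<lambda>n.
      (pochhammer (1/9 :: rat) n * pochhammer (4/9) n * pochhammer (5/9) n)
        / ((fact n)^2 * pochhammer (1/3) n))"
proof
  assume "constant_term_seq hypergeom"
  then show False
  proof (rule constant_term_seq_cong)
    fix N C :: int and B :: nat
    assume N: "N \<noteq> 0"
      and cong: "\<And>p k u w. prime p \<Longrightarrow> B < p \<Longrightarrow> k > 0 \<Longrightarrow>
        hypergeom (p ^ k) * of_int w = of_int u \<Longrightarrow> [N * u = C * w] (mod int p)"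
    obtain p where p: "prime p" "p > B + nat \<bar>N\<bar> + 9" "p mod 3 = 2"
      by (rule primes_2_mod_3_unbounded)
    have ndvd: "\<not> int p dvd N" using N p(2) dvd_imp_le_int[of N "int p"] by auto
    show False
    proof (rule hypergeom_not_cong[OF p(1) _ p(3) ndvd])
      show "p > 9" using p(2) by simp
      fix k :: nat and u w :: int
      assume "k > 0" "hypergeom (p ^ k) * of_int w = of_int u"
      then show "[N * u = C * w] (mod int p)"
        using p(2) by (intro cong[OF p(1)]) auto
    qed
  qed
qed

end
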